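(* Let $n\ge 1$, let $(U_1,U_2)$ be a continuous unitary sewing system on $\mathbb R^2$ with values in $U(n)$, let $A\colon\mathbb R^2\to GL(n,\mathbb C)$ be a continuous equivariant cocycle over the translation $Sw=w+\tau$, $\tau=(\alpha,\beta)$, and assume that $1,\alpha,\beta$ are rationally independent over $\mathbb Q$. Let $\ell$ be a continuous invariant line whose induced line bundle $L\to\mathbb T^2$ has $c_1(L)\neq 0$, and assume that $(A,\ell)$ satisfies the phase-coboundary hypothesis: with $g$ the continuous zero-winding phase of the multiplier of $\ell$, there is a measurable $v\colon\mathbb T^2\to\mathbb R$ with $$v(w)-v(Sw)=g(w)-\langle g\rangle\qquad\text{for a.e. }w .$$ Then for every $\lambda\in\mathbb C$, every measurable section $F$ of $V$ satisfying $A(w)F(w)=\lambda F(w+\tau)$ for a.e. $w$ and $F(w)\in\ell(w)$ for a.e. $w$ vanishes almost everywhere. In particular $L$ carries no measurable eigensection, and a fortiori no eigensection in $\mathcal H_U$.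
   Context: Notation. $\mathbb T^2=\mathbb R^2/\mathbb Z^2$ with coordinates $w=(w_1,w_2)$, Haar probability measure $\mu$, orientation $dw_1\wedge dw_2$; $e_1=(1,0)$, $e_2=(0,1)$; $\langle h\rangle=\int_{\mathbb T^2}h\,d\mu$. The inner product $\langle\cdot,\cdot\rangle$ on $\mathbb C^n$ is conjugate-linear in the first slot. $\tau=(\alpha,\beta)\in\mathbb R^2$ and $Sw=w+\tau$. Sewing system. A continuous unitary sewing system is a pair of continuous maps $U_1,U_2\colon\mathbb R^2\to U(n)$ with $U_1(w+e_2)U_2(w)=U_2(w+e_1)U_1(w)$ for all $w$. It presents a Hermitian vector bundle $V\to\mathbb T^2$ of rank $n$, the quotient of $\mathbb R^2\times\mathbb C^n$ by the $\mathbb Z^2$-action generated by $(w,\xi)\mapsto(w+e_j,U_j(w)\xi)$. Measurable sections of $V$ are measurable $F\colon\mathbb R^2\to\mathbb C^n$ with $F(w+e_j)=U_j(w)F(w)$ a.e., $j=1,2$. $\mathcal H_U$ is the Hilbert space of measurable sections (mod null sets) with $\|F\|^2=\int_{[0,1)^2}|F|^2<\infty$. Cocycle. A continuous equivariant cocycle is a continuous $A\colon\mathbb R^2\to GL(n,\mathbb C)$ with $A(w+e_j)U_j(w)=U_j(Sw)A(w)$ for $j=1,2$ and all $w$. A measurable eigensection is a measurable section $F$ of $V$, not a.e. zero, with $A(w)F(w)=\lambda F(Sw)$ a.e. for some $\lambda\in\mathbb C$ (no integrability assumed). Invariant line. A continuous invariant line is a continuous map $\ell$ from $\mathbb R^2$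 to the projective space of lines through $0$ in $\mathbb C^n$ with $\ell(w+e_j)=U_j(w)\ell(w)$ and $A(w)\ell(w)=\ell(Sw)$ for all $w$, $j=1,2$. It induces a complex line subbundle $L\subset V$ over $\mathbb T^2$. A measurable section $F$ is carried by $\ell$ (or by $L$) if $F(w)\in\ell(w)$ a.e. Charge and multiplier. There are a continuous $e\colon\mathbb R^2\to\mathbb C^n$ with $|e|=1$, $e(w)\in\ell(w)$, and a unique integer $m$ (the charge of $\ell$) with $e(w+e_1)=U_1(w)e(w)$ and $e(w+e_2)=\mathrm e^{2\pi\mathrm i m w_1}U_2(w)e(w)$; such $e$ is called a normalized unit section. Its multiplier is $q(w)=\langle e(Sw),A(w)e(w)\rangle$, so $A(w)e(w)=q(w)e(Sw)$; $q$ is continuous and zero-free. The function $p(w)=\frac{q(w)}{|q(w)|}\mathrm e^{2\pi\mathrm i m\alpha w_2}$ is continuous, $\mathbb Z^2$-periodic and unimodular. Let $k\in\mathbb Z^2$ be its winding vector and $g\colon\mathbb T^2\to\mathbb R$ a continuous function (unique up to an additive integer) with $p(w)=\mathrm e^{2\pi\mathrm i(k\cdot w+g(w))}$. The validity of the phase-coboundary hypothesis does not depend on the choice of $e$. *)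

theory Defs
  imports "HOL-Analysis.Analysis"
begin

text \<open>
  The plane is \<open>real \<times> real\<close>, and functions on the torus are functions on the plane that are
  periodic under integer translations.  The Haar integral over the torus is the Lebesgue integral
  over \<open>unit_square\<close>.  Vectors are \<open>complex ^ 'n\<close>, with the Euclidean norm.
\<close>

definition e1 :: "real \<times> real" where "e1 = (1, 0)"
definition e2 :: "real \<times> real" where "e2 = (0, 1)"

definition unit_square :: "(real \<times> real) set" where
  "unit_square = {0..<1} \<times> {0..<1}"

definition periodic :: "(real \<times> real \<Rightarrow> 'a) \<Rightarrow> bool" where
  "periodic f \<longleftrightarrow> (\<forall>w. f (w + e1) = f w \<and> f (w + e2) = f w)"

definition torus_mean :: "(real \<times> real \<Rightarrow> real) \<Rightarrow> real" where
  "torus_mean h = (LINT w:unit_square|lebesgue. h w)"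

definition cinner :: "complex ^ 'n \<Rightarrow> complex ^ 'n \<Rightarrow> complex" where
  "cinner x y = (\<Sum>i\<in>UNIV. cnj (x $ i) * y $ i)"

definition hermitian_adjoint :: "complex ^ 'n ^ 'm \<Rightarrow> complex ^ 'm ^ 'n" where
  "hermitian_adjoint M = (\<chi> i j. cnj (M $ j $ i))"

definition unitary :: "complex ^ 'n ^ 'n \<Rightarrow> bool" where
  "unitary M \<longleftrightarrow> hermitian_adjoint M ** M = mat 1 \<and> M ** hermitian_adjoint M = mat 1"

definition rationally_independent :: "real \<Rightarrow> real \<Rightarrow> real \<Rightarrow> bool" where
  "rationally_independent x y z \<longleftrightarrow>
     (\<forall>a b c :: rat. of_rat a * x + of_rat b * y + of_rat c * z = 0 \<longrightarrow> a = 0 \<and> b = 0 \<and> c = 0)"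

definition sewing_system ::
    "(real \<times> real \<Rightarrow> complex ^ 'n ^ 'n) \<Rightarrow> (real \<times> real \<Rightarrow> complex ^ 'n ^ 'n) \<Rightarrow> bool" where
  "sewing_system U1 U2 \<longleftrightarrow>
     continuous_on UNIV U1 \<and> continuous_on UNIV U2 \<and>
     (\<forall>w. unitary (U1 w)) \<and> (\<forall>w. unitary (U2 w)) \<and>
     (\<forall>w. U1 (w + e2) ** U2 w = U2 (w + e1) ** U1 w)"

definition measurable_section ::
    "(real \<times> real \<Rightarrow> complex ^ 'n ^ 'n) \<Rightarrow> (real \<times> real \<Rightarrow> complex ^ 'n ^ 'n) \<Rightarrow>
     (real \<times> real \<Rightarrow> complex ^ 'n) \<Rightarrow> bool" where
  "measurable_section U1 U2 F \<longleftrightarrow>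
     F \<in> borel_measurable lebesgue \<and>
     (AE w in lebesgue. F (w + e1) = U1 w *v F w) \<and>
     (AE w in lebesgue. F (w + e2) = U2 w *v F w)"

text \<open>The elements of the Hilbert space of sections, before identifying a.e. equal functions.\<close>

definition L2_section ::
    "(real \<times> real \<Rightarrow> complex ^ 'n ^ 'n) \<Rightarrow> (real \<times> real \<Rightarrow> complex ^ 'n ^ 'n) \<Rightarrow>
     (real \<times> real \<Rightarrow> complex ^ 'n) \<Rightarrow> bool" where
  "L2_section U1 U2 F \<longleftrightarrow>
     measurable_section U1 U2 F \<and> set_integrable lebesgue unit_square (\<lambda>w. (norm (F w))\<^sup>2)"

definition equivariant_cocycle ::
    "(real \<times> real \<Rightarrow> complex ^ 'n ^ 'n) \<Rightarrow> (real \<times> real \<Rightarrow> complex ^ 'n ^ 'n) \<Rightarrow>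
     real \<times> real \<Rightarrow> (real \<times> real \<Rightarrow> complex ^ 'n ^ 'n) \<Rightarrow> bool" where
  "equivariant_cocycle U1 U2 \<tau> A \<longleftrightarrow>
     continuous_on UNIV A \<and> (\<forall>w. invertible (A w)) \<and>
     (\<forall>w. A (w + e1) ** U1 w = U1 (w + \<tau>) ** A w) \<and>
     (\<forall>w. A (w + e2) ** U2 w = U2 (w + \<tau>) ** A w)"

definition eigen_equation ::
    "(real \<times> real \<Rightarrow> complex ^ 'n ^ 'n) \<Rightarrow> real \<times> real \<Rightarrow> complex \<Rightarrow>
     (real \<times> real \<Rightarrow> complex ^ 'n) \<Rightarrow> bool" where
  "eigen_equation A \<tau> lam F \<longleftrightarrow> (AE w in lebesgue. A w *v F w = lam *s F (w + \<tau>))"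

definition measurable_eigensection ::
    "(real \<times> real \<Rightarrow> complex ^ 'n ^ 'n) \<Rightarrow> (real \<times> real \<Rightarrow> complex ^ 'n ^ 'n) \<Rightarrow>
     (real \<times> real \<Rightarrow> complex ^ 'n ^ 'n) \<Rightarrow> real \<times> real \<Rightarrow>
     (real \<times> real \<Rightarrow> complex ^ 'n) \<Rightarrow> bool" where
  "measurable_eigensection U1 U2 A \<tau> F \<longleftrightarrow>
     measurable_section U1 U2 F \<and> \<not> (AE w in lebesgue. F w = 0) \<and> (\<exists>lam. eigen_equation A \<tau> lam F)"

text \<open>
  Lines through 0 are one-dimensional complex subspaces; \<open>vec.span\<close> is the span over the
  scalar field \<open>complex\<close>.  The set of lines carries the quotient topology.
\<close>

definition complex_lines :: "(complex ^ 'n) set set" where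
  "complex_lines = (\<lambda>v. vec.span {v}) ` (- {0})"

definition projective_topology :: "(complex ^ 'n) set topology" where
  "projective_topology =
     topology (\<lambda>T. T \<subseteq> complex_lines \<and> open {v. v \<noteq> 0 \<and> vec.span {v} \<in> T})"

lemma openin_projective_topology:
  "openin projective_topology T \<longleftrightarrow>
     T \<subseteq> complex_lines \<and> open {v :: complex ^ 'n. v \<noteq> 0 \<and> vec.span {v} \<in> T}"
proof -
  have "istopology (\<lambda>T. T \<subseteq> complex_lines \<and> open {v :: complex ^ 'n. v \<noteq> 0 \<and> vec.span {v} \<in> T})"
    unfolding istopology_def
  proof (intro conjI allI impI)
    fix S T :: "(complex ^ 'n) set set"
    assume S: "S \<subseteq> complex_lines \<and> open {v. v \<noteq> 0 \<and> vec.span {v} \<in> S}"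
      and T: "T \<subseteq> complex_lines \<and> open {v. v \<noteq> 0 \<and> vec.span {v} \<in> T}"
    show "S \<inter> T \<subseteq> complex_lines" using S by blast
    have "{v. v \<noteq> 0 \<and> vec.span {v} \<in> S \<inter> T} =
        {v. v \<noteq> 0 \<and> vec.span {v} \<in> S} \<inter> {v. v \<noteq> 0 \<and> vec.span {v} \<in> T}" by blast
    then show "open {v. v \<noteq> 0 \<and> vec.span {v} \<in> S \<inter> T}" using S T by (simp add: open_Int)
  next
    fix K :: "(complex ^ 'n) set set set"
    assume K: "\<forall>T\<in>K. T \<subseteq> complex_lines \<and> open {v. v \<noteq> 0 \<and> vec.span {v} \<in> T}"
    then show "\<Union>K \<subseteq> complex_lines" by blast
    have "{v. v \<noteq> 0 \<and> vec.span {v} \<in> \<Union>K} = (\<Union>T\<in>K. {v. v \<noteq> 0 \<and> vec.span {v} \<in> T})" by blast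
    then show "open {v. v \<noteq> 0 \<and> vec.span {v} \<in> \<Union>K}" using K by (metis (no_types, lifting) open_UN)
  qed
  then show ?thesis by (simp add: projective_topology_def topology_inverse')
qed

lemma topspace_projective_topology: "topspace projective_topology = complex_lines"
proof
  show "topspace projective_topology \<subseteq> (complex_lines :: (complex ^ 'n) set set)"
    using openin_projective_topology openin_topspace by blast
  have eq: "{v :: complex ^ 'n. v \<noteq> 0 \<and> vec.span {v} \<in> complex_lines} = - {0}"
    by (auto simp: complex_lines_def)
  have "open (- {0 :: complex ^ 'n})"
    by (rule open_Compl) (rule closed_singleton)
  then have "openin projective_topology (complex_lines :: (complex ^ 'n) set set)"
    unfolding openin_projective_topology eq by (intro conjI subset_refl)
  then show "(complex_lines :: (complex ^ 'n) set set) \<subseteq> topspace projective_topology"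
    by (rule openin_subset)
qed

lemma quotient_map_projective_topology:
  "quotient_map (top_of_set (- {0 :: complex ^ 'n})) projective_topology (\<lambda>v. vec.span {v})"
  unfolding quotient_map_def
proof (intro conjI allI impI)
  show "(\<lambda>v :: complex ^ 'n. vec.span {v}) ` topspace (top_of_set (- {0})) =
      topspace projective_topology"
    unfolding topspace_projective_topology complex_lines_def by (simp only: topspace_euclidean_subtopology)
next
  fix T :: "(complex ^ 'n) set set"
  assume "T \<subseteq> topspace projective_topology"
  then have T: "T \<subseteq> complex_lines" unfolding topspace_projective_topology .
  have "open (- {0 :: complex ^ 'n})"
    by (rule open_Compl) (rule closed_singleton)
  moreover have eq: "{v \<in> topspace (top_of_set (- {0})). vec.span {v} \<in> T} =
      {v :: complex ^ 'n. v \<noteq> 0 \<and> vec.span {v} \<in> T}"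
    by (simp only: topspace_euclidean_subtopology Compl_iff singleton_iff)
  ultimately have "openin (top_of_set (- {0})) {v \<in> topspace (top_of_set (- {0})). vec.span {v} \<in> T} \<longleftrightarrow>
      open {v :: complex ^ 'n. v \<noteq> 0 \<and> vec.span {v} \<in> T}"
    unfolding eq by (subst openin_open_eq) blast+
  then show "openin (top_of_set (- {0})) {v \<in> topspace (top_of_set (- {0})). vec.span {v} \<in> T} =
      openin projective_topology T"
    unfolding openin_projective_topology using T by blast
qed

definition invariant_line ::
    "(real \<times> real \<Rightarrow> complex ^ 'n ^ 'n) \<Rightarrow> (real \<times> real \<Rightarrow> complex ^ 'n ^ 'n) \<Rightarrow>
     (real \<times> real \<Rightarrow> complex ^ 'n ^ 'n) \<Rightarrow> real \<times> real \<Rightarrow>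
     (real \<times> real \<Rightarrow> (complex ^ 'n) set) \<Rightarrow> bool" where
  "invariant_line U1 U2 A \<tau> l \<longleftrightarrow>
     continuous_map euclidean projective_topology l \<and>
     (\<forall>w. l (w + e1) = (\<lambda>v. U1 w *v v) ` l w) \<and>
     (\<forall>w. l (w + e2) = (\<lambda>v. U2 w *v v) ` l w) \<and>
     (\<forall>w. (\<lambda>v. A w *v v) ` l w = l (w + \<tau>))"

lemma invariant_line_complex_lines:
  assumes "invariant_line U1 U2 A \<tau> l"
  shows "l w \<in> complex_lines"
proof -
  have "continuous_map euclidean projective_topology l"
    using assms unfolding invariant_line_def by (rule conjunct1)
  then have "l \<in> topspace euclidean \<rightarrow> topspace projective_topology"
    by (rule continuous_map_funspace)
  then have "l w \<in> topspace projective_topology"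
    by (rule funcset_mem) (simp only: topspace_euclidean UNIV_I)
  then show ?thesis unfolding topspace_projective_topology .
qed

definition carried_by ::
    "(real \<times> real \<Rightarrow> (complex ^ 'n) set) \<Rightarrow> (real \<times> real \<Rightarrow> complex ^ 'n) \<Rightarrow> bool" where
  "carried_by l F \<longleftrightarrow> (AE w in lebesgue. F w \<in> l w)"

text \<open>
  The induced line bundle is presented by its factors of automorphy: relative to a continuous
  nowhere vanishing frame \<open>s\<close> of the pulled back bundle over the plane, they are
  \<open>exp (- 2 \<pi> \<i> f1)\<close> and \<open>exp (- 2 \<pi> \<i> f2)\<close>, that is, a function \<open>\<phi>\<close> represents a section
  \<open>\<phi> s\<close> iff \<open>\<phi> (w + ej) = exp (- 2 \<pi> \<i> fj w) \<phi> w\<close>.  The integer below is the class obtained from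
  these factors via the connecting homomorphism of the exponential sequence, evaluated on the
  fundamental class for the orientation \<open>dw1 \<and> dw2\<close>.  It is the increase of \<open>arg \<phi> / (2 \<pi>)\<close>
  along the positively oriented boundary of a period square, i.e. the signed number of zeros of
  a section.  It depends neither on \<open>w\<close> nor on the choice of \<open>s\<close>, \<open>f1\<close> and \<open>f2\<close>.
\<close>

definition has_chern_number ::
    "(real \<times> real \<Rightarrow> complex ^ 'n ^ 'n) \<Rightarrow> (real \<times> real \<Rightarrow> complex ^ 'n ^ 'n) \<Rightarrow>
     (real \<times> real \<Rightarrow> (complex ^ 'n) set) \<Rightarrow> int \<Rightarrow> bool" where
  "has_chern_number U1 U2 l c \<longleftrightarrow>
     (\<exists>(s :: real \<times> real \<Rightarrow> complex ^ 'n) (f1 :: real \<times> real \<Rightarrow> complex) (f2 :: real \<times> real \<Rightarrow> complex).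
        continuous_on UNIV s \<and> continuous_on UNIV f1 \<and> continuous_on UNIV f2 \<and>
        (\<forall>w. s w \<noteq> 0 \<and> s w \<in> l w) \<and>
        (\<forall>w. s (w + e1) = exp (2 * of_real pi * \<i> * f1 w) *s (U1 w *v s w)) \<and>
        (\<forall>w. s (w + e2) = exp (2 * of_real pi * \<i> * f2 w) *s (U2 w *v s w)) \<and>
        (\<forall>w. of_int c = (f2 (w + e1) - f2 w) - (f1 (w + e2) - f1 w)))"

definition chern_number ::
    "(real \<times> real \<Rightarrow> complex ^ 'n ^ 'n) \<Rightarrow> (real \<times> real \<Rightarrow> complex ^ 'n ^ 'n) \<Rightarrow>
     (real \<times> real \<Rightarrow> (complex ^ 'n) set) \<Rightarrow> int" where
  "chern_number U1 U2 l = (THE c. has_chern_number U1 U2 l c)"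

lemma exp_quotient_integer_constant:
  fixes d :: "real \<times> real \<Rightarrow> complex"
  assumes "continuous_on UNIV d" and "\<And>w. exp (2 * of_real pi * \<i> * d w) = 1"
  shows "d x = d y"
proof -
  have int: "d w \<in> \<int>" for w
  proof -
    obtain n :: int where n: "Re (2 * of_real pi * \<i> * d w) = 0"
      "Im (2 * of_real pi * \<i> * d w) = of_int (2 * n) * pi"
      using assms(2)[of w] exp_eq_1 by blast
    then have "d w = of_int n" by (auto simp: complex_eq_iff)
    then show ?thesis by simp
  qed
  have "d constant_on UNIV"
  proof (rule continuous_discrete_range_constant)
    show "connected (UNIV :: (real \<times> real) set)" by (simp add: connected_UNIV)
    show "continuous_on UNIV d" by fact
    fix x
    show "\<exists>e>0. \<forall>y. y \<in> UNIV \<and> d y \<noteq> d x \<longrightarrow> e \<le> norm (d y - d x)"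
    proof (intro exI[of _ 1] conjI allI impI)
      fix y assume "y \<in> UNIV \<and> d y \<noteq> d x"
      then have "d y - d x \<noteq> 0" by simp
      moreover obtain k :: int where "d y - d x = of_int k"
        using Ints_diff[OF int int] by (rule Ints_cases)
      ultimately show "1 \<le> norm (d y - d x)" by simp
    qed simp
  qed
  then show ?thesis by (metis UNIV_I constant_on_def)
qed

lemma has_chern_number_unique:
  fixes l :: "real \<times> real \<Rightarrow> (complex ^ 'n) set"
  assumes line: "\<And>w. l w \<in> complex_lines"
    and c: "has_chern_number U1 U2 l c" and c': "has_chern_number U1 U2 l c'"
  shows "c = c'"
proof -
  obtain s :: "real \<times> real \<Rightarrow> complex ^ 'n" and f1 f2 :: "real \<times> real \<Rightarrow> complex" where
    s: "continuous_on UNIV s" "continuous_on UNIV f1" "continuous_on UNIV f2"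
      "\<And>w. s w \<noteq> 0" "\<And>w. s w \<in> l w"
      "\<And>w. s (w + e1) = exp (2 * of_real pi * \<i> * f1 w) *s (U1 w *v s w)"
      "\<And>w. s (w + e2) = exp (2 * of_real pi * \<i> * f2 w) *s (U2 w *v s w)"
      "\<And>w. of_int c = (f2 (w + e1) - f2 w) - (f1 (w + e2) - f1 w)"
    using c unfolding has_chern_number_def by metis
  obtain t :: "real \<times> real \<Rightarrow> complex ^ 'n" and h1 h2 :: "real \<times> real \<Rightarrow> complex" where
    t: "continuous_on UNIV t" "continuous_on UNIV h1" "continuous_on UNIV h2"
      "\<And>w. t w \<noteq> 0" "\<And>w. t w \<in> l w"
      "\<And>w. t (w + e1) = exp (2 * of_real pi * \<i> * h1 w) *s (U1 w *v t w)"
      "\<And>w. t (w + e2) = exp (2 * of_real pi * \<i> * h2 w) *s (U2 w *v t w)"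
      "\<And>w. of_int c' = (h2 (w + e1) - h2 w) - (h1 (w + e2) - h1 w)"
    using c' unfolding has_chern_number_def by metis
  define r where "r w = cinner (s w) (t w) / cinner (s w) (s w)" for w
  have ss: "cinner (s w) (s w) \<noteq> 0" for w
  proof -
    have "Re (cinner (s w) (s w)) = (\<Sum>i\<in>UNIV. (cmod (s w $ i))\<^sup>2)"
      unfolding cinner_def cmod_power2 by (simp add: power2_eq_square)
    moreover obtain i where "s w $ i \<noteq> 0" using s(4)[of w] by (auto simp: vec_eq_iff)
    then have "(\<Sum>i\<in>UNIV. (cmod (s w $ i))\<^sup>2) > 0"
      by (intro sum_pos2[of _ i]) auto
    ultimately show ?thesis by auto
  qed
  have tr: "t w = r w *s s w" for w
  proof -
    obtain v where v: "l w = vec.span {v}" "v \<noteq> 0" using line[of w] by (auto simp: complex_lines_def)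
    obtain a b where ab: "s w = a *s v" "t w = b *s v"
      using s(5)[of w] t(5)[of w] v by (auto simp: vec.span_singleton)
    then have "a \<noteq> 0" using s(4)[of w] by auto
    then have eq: "t w = (b / a) *s s w" using ab by (simp add: vec_eq_iff)
    then have "cinner (s w) (t w) = (b / a) * cinner (s w) (s w)"
      by (simp add: cinner_def sum_distrib_left algebra_simps)
    then have "r w = b / a" using ss[of w] by (simp add: r_def)
    then show ?thesis using eq by simp
  qed
  have r0: "r w \<noteq> 0" for w using tr[of w] t(4)[of w] by auto
  have rc: "continuous_on UNIV r"
    unfolding r_def cinner_def using ss s(1) t(1)
    by (auto intro!: continuous_intros simp: cinner_def)
  obtain \<theta>0 where \<theta>0: "continuous_on UNIV \<theta>0" "\<And>w. r w = exp (\<theta>0 w)"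
    using continuous_logarithm_on_contractible[OF rc convex_imp_contractible[OF convex_UNIV]] r0 by auto
  have key: "h x - f x - (\<theta>0 (x + e) - \<theta>0 x) / (2 * of_real pi * \<i>) =
             h y - f y - (\<theta>0 (y + e) - \<theta>0 y) / (2 * of_real pi * \<i>)"
    if "continuous_on UNIV f" "continuous_on UNIV h"
      "\<And>w. s (w + e) = exp (2 * of_real pi * \<i> * f w) *s (U w *v s w)"
      "\<And>w. t (w + e) = exp (2 * of_real pi * \<i> * h w) *s (U w *v t w)" for f h e U x y
  proof (rule exp_quotient_integer_constant)
    have "continuous_on UNIV (\<lambda>w. \<theta>0 (w + e))"
      by (rule continuous_on_compose2[OF \<theta>0(1)]) (auto intro!: continuous_intros)
    then show "continuous_on UNIV (\<lambda>x. h x - f x - (\<theta>0 (x + e) - \<theta>0 x) / (2 * of_real pi * \<i>))"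
      using that(1,2) \<theta>0(1) by (intro continuous_intros) auto
    fix w
    have u: "U w *v s w \<noteq> 0" using that(3)[of w] s(4)[of "w + e"] by auto
    have "t (w + e) = (exp (\<theta>0 (w + e)) * exp (2 * of_real pi * \<i> * f w)) *s (U w *v s w)"
      using tr[of "w + e"] that(3)[of w] \<theta>0(2)[of "w+e"] by simp
    moreover have "t (w + e) = (exp (\<theta>0 w) * exp (2 * of_real pi * \<i> * h w)) *s (U w *v s w)"
      using that(4)[of w] tr[of w] \<theta>0(2)[of w] by (simp add: vec.scale mult.commute)
    ultimately have "exp (\<theta>0 (w + e)) * exp (2 * of_real pi * \<i> * f w)
        = exp (\<theta>0 w) * exp (2 * of_real pi * \<i> * h w)"
      using u by (metis vec.scale_right_imp_eq)
    moreover have "2 * of_real pi * \<i> * (h w - f w - (\<theta>0 (w + e) - \<theta>0 w) / (2 * of_real pi * \<i>)) =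
        (\<theta>0 w + 2 * of_real pi * \<i> * h w) - (\<theta>0 (w + e) + 2 * of_real pi * \<i> * f w)"
      by (simp add: field_simps)
    ultimately show "exp (2 * of_real pi * \<i> * (h w - f w - (\<theta>0 (w + e) - \<theta>0 w) / (2 * of_real pi * \<i>))) = 1"
      by (simp only: exp_diff exp_add) simp
  qed
  have "h1 0 - f1 0 - (\<theta>0 (0 + e1) - \<theta>0 0) / (2 * of_real pi * \<i>) =
        h1 (0 + e2) - f1 (0 + e2) - (\<theta>0 ((0 + e2) + e1) - \<theta>0 (0 + e2)) / (2 * of_real pi * \<i>)"
    by (rule key[where f = f1 and h = h1 and e = e1 and U = U1, OF s(2) t(2) s(6) t(6)])
  moreover have "h2 0 - f2 0 - (\<theta>0 (0 + e2) - \<theta>0 0) / (2 * of_real pi * \<i>) =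
        h2 (0 + e1) - f2 (0 + e1) - (\<theta>0 ((0 + e1) + e2) - \<theta>0 (0 + e1)) / (2 * of_real pi * \<i>)"
    by (rule key[where f = f2 and h = h2 and e = e2 and U = U2, OF s(3) t(3) s(7) t(7)])
  ultimately have "(h2 e1 - h2 0) - (h1 e2 - h1 0) = (f2 e1 - f2 0) - (f1 e2 - f1 0)"
    by (simp add: diff_divide_distrib add.commute) algebra
  then have "(of_int c :: complex) = of_int c'"
    using s(8)[of 0] t(8)[of 0] by simp
  then show ?thesis by simp
qed

definition normalized_unit_section ::
    "(real \<times> real \<Rightarrow> complex ^ 'n ^ 'n) \<Rightarrow> (real \<times> real \<Rightarrow> complex ^ 'n ^ 'n) \<Rightarrow>
     (real \<times> real \<Rightarrow> (complex ^ 'n) set) \<Rightarrow> int \<Rightarrow> (real \<times> real \<Rightarrow> complex ^ 'n) \<Rightarrow> bool" where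
  "normalized_unit_section U1 U2 l m e \<longleftrightarrow>
     continuous_on UNIV e \<and> (\<forall>w. norm (e w) = 1 \<and> e w \<in> l w) \<and>
     (\<forall>w. e (w + e1) = U1 w *v e w) \<and>
     (\<forall>w. e (w + e2) = exp (2 * of_real pi * \<i> * of_int m * of_real (fst w)) *s (U2 w *v e w))"

lemma has_chern_number_charge:
  assumes "normalized_unit_section U1 U2 l m e"
  shows "has_chern_number U1 U2 l m"
  unfolding has_chern_number_def
proof (intro exI conjI)
  let ?f2 = "\<lambda>w :: real \<times> real. of_int m * of_real (fst w) :: complex"
  show "continuous_on UNIV e" "\<forall>w. e w \<noteq> 0 \<and> e w \<in> l w"
    using assms unfolding normalized_unit_section_def by (auto, metis norm_zero zero_neq_one)
  show "continuous_on UNIV (\<lambda>_ :: real \<times> real. 0 :: complex)" by simp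
  show "continuous_on UNIV ?f2" by (intro continuous_intros)
  show "\<forall>w. e (w + e1) = exp (2 * of_real pi * \<i> * 0) *s (U1 w *v e w)"
    using assms by (simp add: normalized_unit_section_def)
  show "\<forall>w. e (w + e2) = exp (2 * of_real pi * \<i> * ?f2 w) *s (U2 w *v e w)"
    using assms by (simp add: normalized_unit_section_def mult.assoc)
  show "\<forall>w. of_int m = (?f2 (w + e1) - ?f2 w) - (0 - 0)"
    by (simp add: e1_def algebra_simps)
qed

lemma chern_number_eq_charge:
  assumes "\<And>w. l w \<in> complex_lines" and "normalized_unit_section U1 U2 l m e"
  shows "chern_number U1 U2 l = m"
  unfolding chern_number_def
proof (rule the_equality)
  show m: "has_chern_number U1 U2 l m" by (rule has_chern_number_charge[OF assms(2)])
  fix c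
  assume "has_chern_number U1 U2 l c"
  then show "c = m" by (rule has_chern_number_unique[OF assms(1) _ m])
qed

definition multiplier ::
    "(real \<times> real \<Rightarrow> complex ^ 'n ^ 'n) \<Rightarrow> real \<times> real \<Rightarrow> (real \<times> real \<Rightarrow> complex ^ 'n) \<Rightarrow>
     real \<times> real \<Rightarrow> complex" where
  "multiplier A \<tau> e w = cinner (e (w + \<tau>)) (A w *v e w)"

definition phase ::
    "(real \<times> real \<Rightarrow> complex ^ 'n ^ 'n) \<Rightarrow> real \<times> real \<Rightarrow> int \<Rightarrow>
     (real \<times> real \<Rightarrow> complex ^ 'n) \<Rightarrow> real \<times> real \<Rightarrow> complex" where
  "phase A \<tau> m e w =
     multiplier A \<tau> e w / of_real (cmod (multiplier A \<tau> e w)) *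
     exp (2 * of_real pi * \<i> * of_int m * of_real (fst \<tau>) * of_real (snd w))"

text \<open>Since \<open>g\<close> is continuous and periodic, the integers \<open>k1\<close>, \<open>k2\<close> are the winding numbers of \<open>p\<close>.\<close>

definition zero_winding_phase :: "(real \<times> real \<Rightarrow> complex) \<Rightarrow> (real \<times> real \<Rightarrow> real) \<Rightarrow> bool" where
  "zero_winding_phase p g \<longleftrightarrow>
     continuous_on UNIV g \<and> periodic g \<and>
     (\<exists>k1 k2 :: int. \<forall>w. p w =
        exp (2 * of_real pi * \<i> * of_real (of_int k1 * fst w + of_int k2 * snd w + g w)))"

text \<open>
  A normalized unit section \<open>e\<close> and a phase \<open>g\<close> always exist, \<open>m\<close> is unique, and whether \<open>v\<close>
  exists does not depend on \<open>e\<close> and \<open>g\<close>; hence these are quantified existentially.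
\<close>

definition phase_coboundary ::
    "(real \<times> real \<Rightarrow> complex ^ 'n ^ 'n) \<Rightarrow> (real \<times> real \<Rightarrow> complex ^ 'n ^ 'n) \<Rightarrow>
     (real \<times> real \<Rightarrow> complex ^ 'n ^ 'n) \<Rightarrow> real \<times> real \<Rightarrow>
     (real \<times> real \<Rightarrow> (complex ^ 'n) set) \<Rightarrow> bool" where
  "phase_coboundary U1 U2 A \<tau> l \<longleftrightarrow>
     (\<exists>m e g v. normalized_unit_section U1 U2 l m e \<and>
        zero_winding_phase (phase A \<tau> m e) g \<and>
        v \<in> borel_measurable lebesgue \<and> periodic v \<and>
        (AE w in lebesgue. v w - v (w + \<tau>) = g w - torus_mean g))"

end

theory Submission
  imports Defs "HOL-Analysis.Kronecker_Approximation_Theorem"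
begin

text \<open>
  A section \<open>F\<close> carried by the line is \<open>\<phi> e\<close> with a scalar \<open>\<phi>\<close>, where \<open>e\<close> is a normalized unit
  section of charge \<open>m\<close>; by \<open>chern_number_eq_charge\<close>, \<open>m\<close> is the Chern number and so nonzero.  The
  coboundary hypothesis says that, in the measurable frame \<open>exp (- 2 \<pi> \<i> v) e\<close>, the phase of the
  multiplier is a constant times the exponential of a linear function.  Thus if \<open>F\<close> is an eigensection with a
  nonzero eigenvalue, then \<open>h = sgn \<phi> exp (2 \<pi> \<i> v)\<close> is multiplied by a constant times a character
  under each of the translations by \<open>e1\<close>, \<open>e2\<close> and \<open>\<tau>\<close>, the frequencies being \<open>0\<close>, \<open>(-m, 0)\<close> and
  \<open>(k1, k2 - m \<alpha>)\<close>.  The eigenvalue 0 is immediate.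

  It remains to see that such an \<open>h\<close> vanishes (\<open>charged_quasi_periodic_function_vanishes\<close>).  The
  translations by \<open>n \<tau> - (a, b)\<close>, \<open>n > 0\<close>, that are close to 0 have frequencies with first entry
  \<open>N = n k1 + b m\<close>, approximately \<open>n (k1 + m \<beta>)\<close>, so \<open>N\<close> is a nonzero integer: the charge shears the
  plane, and a recurrence of the translation is not a recurrence of \<open>h\<close>.  On the other hand a
  bounded measurable function hardly changes in mean under a small translation
  (\<open>translation_continuous_in_mean\<close>), so the character of frequency \<open>(N, _)\<close> is almost constant, in
  mean, on the support of \<open>h\<close>.  This support is invariant under the dense set of all translations by
  \<open>n' \<tau> - (a', b')\<close>, one of which lies near \<open>(1 / (2 N), 0)\<close> and nearly reverses the sign of that
  character.  The two statements are compatible only if \<open>h = 0\<close>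
  (\<open>quasi_period_almost_orthogonal\<close>).
\<close>

section \<open>Translations and Lebesgue measure\<close>

lemma lebesgue_distr_translation:
  "distr lebesgue lebesgue (\<lambda>x. c + x) = (lebesgue :: 'a::euclidean_space measure)"
proof -
  have "(lebesgue :: 'a measure) =
      density (distr lebesgue lebesgue (\<lambda>x. c + (\<Sum>j\<in>Basis. (1 * (x \<bullet> j)) *\<^sub>R j))) (\<lambda>_. ennreal (\<Prod>j\<in>(Basis::'a set). \<bar>1\<bar>))"
    by (rule lebesgue_affine_euclidean) simp
  then show ?thesis
    by (simp add: euclidean_representation density_1)
qed

lemma measurable_lebesgue_translation [measurable]:
  "(\<lambda>x. x + c) \<in> lebesgue \<rightarrow>\<^sub>M (lebesgue :: 'a::euclidean_space measure)"
proof -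
  have "(\<lambda>x. c + (\<Sum>j\<in>Basis. (1 * (x \<bullet> j)) *\<^sub>R j)) \<in> lebesgue \<rightarrow>\<^sub>M (lebesgue :: 'a measure)"
    by (rule lebesgue_affine_measurable) simp
  then show ?thesis
    by (simp add: euclidean_representation add.commute)
qed

lemma nn_integral_lebesgue_translation:
  fixes f :: "'a::euclidean_space \<Rightarrow> ennreal"
  assumes "f \<in> borel_measurable lebesgue"
  shows "(\<integral>\<^sup>+x. f (x + c) \<partial>lebesgue) = (\<integral>\<^sup>+x. f x \<partial>lebesgue)"
proof -
  have "(\<integral>\<^sup>+x. f x \<partial>lebesgue) = (\<integral>\<^sup>+x. f x \<partial>distr lebesgue lebesgue (\<lambda>x. x + c))"
    using lebesgue_distr_translation[of c] by (simp add: add.commute)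
  also have "\<dots> = (\<integral>\<^sup>+x. f (x + c) \<partial>lebesgue)"
    using assms by (intro nn_integral_distr) measurable
  finally show ?thesis by simp
qed

lemma AE_lebesgue_translation:
  fixes c :: "'a::euclidean_space"
  assumes "AE x in lebesgue. P x"
  shows "AE x in lebesgue. P (x + c)"
proof -
  have "AE x in distr lebesgue lebesgue (\<lambda>x. x + c). P x"
    unfolding add.commute[of _ c] lebesgue_distr_translation by (rule assms)
  then show ?thesis
    by (rule AE_distrD[OF measurable_lebesgue_translation])
qed

lemma cball_in_sets_lebesgue [measurable]: "cball c R \<in> sets (lebesgue :: 'a::euclidean_space measure)"
  by simp

text \<open>
  A measurable function is an a.e. limit of continuous functions.  Radial retraction onto the unit
  disc makes the approximants bounded without disturbing the limit, so that dominated convergence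
  on a ball applies.
\<close>

lemma continuous_approximation_in_mean:
  fixes h :: "'a::euclidean_space \<Rightarrow> complex"
  assumes h: "h \<in> borel_measurable lebesgue" and bound: "\<And>w. norm (h w) \<le> 1" and "\<eta> > 0"
  obtains g where "continuous_on UNIV g"
    "(\<integral>\<^sup>+w. ennreal (norm (h w - g w)) * indicator (cball 0 R) w \<partial>lebesgue) < ennreal \<eta>"
proof -
  obtain N g where N: "negligible N" and g: "\<And>n. continuous_on UNIV (g n)"
    and lim: "\<And>w. w \<notin> N \<Longrightarrow> (\<lambda>n. g n w) \<longlonglongrightarrow> h w"
    using lebesgue_measurable_imp_measurable_on[OF h, of UNIV] unfolding measurable_on_def by auto
  define r where "r z = z /\<^sub>R max 1 (norm z)" for z :: complex
  have r_cont: "continuous_on UNIV r"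
    unfolding r_def by (intro continuous_intros) auto
  have r_bound: "norm (r z) \<le> 1" for z
    by (auto simp: r_def divide_simps max_def)
  have r_id: "r (h w) = h w" for w
    using bound[of w] by (simp add: r_def max_def)
  let ?u = "\<lambda>n w. indicator (cball 0 R) w *\<^sub>R r (g n w)"
  let ?u' = "\<lambda>w. indicator (cball 0 R) w *\<^sub>R h w"
  have rg: "continuous_on UNIV (\<lambda>w. r (g n w))" for n
    by (rule continuous_on_compose2[OF r_cont g]) auto
  then have rgm [measurable]: "(\<lambda>w. r (g n w)) \<in> borel_measurable lebesgue" for n
    by (intro measurable_completion) (simp add: borel_measurable_continuous_onI)
  have "(\<lambda>n. \<integral>\<^sup>+w. norm (?u' w - ?u n w) \<partial>lebesgue) \<longlonglongrightarrow> 0"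
  proof (rule nn_integral_dominated_convergence_norm[where w = "indicator (cball 0 R)"])
    show "?u n \<in> borel_measurable lebesgue" for n
      using rgm by measurable
    show "?u' \<in> borel_measurable lebesgue"
      using h by measurable
    show "AE w in lebesgue. norm (?u n w) \<le> indicator (cball 0 R) w" for n
      using r_bound by (auto simp: indicator_def)
    have "emeasure lebesgue (cball 0 R :: 'a set) < \<infinity>"
      using emeasure_bounded_finite[OF bounded_cball] by simp
    then show "(\<integral>\<^sup>+w. ennreal (indicator (cball 0 R :: 'a set) w) \<partial>lebesgue) < \<infinity>"
      by (simp add: ennreal_indicator)
    have "(\<lambda>n. ?u n w) \<longlonglongrightarrow> ?u' w" if "w \<notin> N" for w
    proof -
      have "(\<lambda>n. r (g n w)) \<longlonglongrightarrow> r (h w)"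
        using r_cont lim[OF that]
        by (intro isCont_tendsto_compose[of _ r]) (simp_all add: continuous_on_eq_continuous_at)
      then show ?thesis
        unfolding r_id by (intro tendsto_intros)
    qed
    moreover have "AE w in lebesgue. w \<notin> N"
      using N by (intro AE_not_in) (simp add: negligible_iff_null_sets)
    ultimately show "AE w in lebesgue. (\<lambda>n. ?u n w) \<longlonglongrightarrow> ?u' w"
      by auto
  qed measurable
  then have "eventually (\<lambda>n. (\<integral>\<^sup>+w. norm (?u' w - ?u n w) \<partial>lebesgue) < ennreal \<eta>) sequentially"
    by (rule order_tendstoD) (simp add: \<open>\<eta> > 0\<close>)
  then obtain n where n: "(\<integral>\<^sup>+w. norm (?u' w - ?u n w) \<partial>lebesgue) < ennreal \<eta>"
    by (auto dest: eventually_happens)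
  have "(\<integral>\<^sup>+w. ennreal (norm (h w - r (g n w))) * indicator (cball 0 R) w \<partial>lebesgue) =
      (\<integral>\<^sup>+w. norm (?u' w - ?u n w) \<partial>lebesgue)"
    by (rule nn_integral_cong) (auto simp: indicator_def)
  with n show thesis
    using that[OF rg[of n]] by simp
qed

text \<open>
  For a continuous function this is uniform continuity on a slightly larger ball; the continuous
  approximation in mean carries it over, because Lebesgue measure is translation invariant.
\<close>

lemma translation_continuous_in_mean:
  fixes h :: "'a::euclidean_space \<Rightarrow> complex"
  assumes h [measurable]: "h \<in> borel_measurable lebesgue" and bound: "\<And>w. norm (h w) \<le> 1" and "\<eta> > 0"
  obtains \<delta> where "\<delta> > 0"
    "\<And>c. norm c < \<delta> \<Longrightarrow>
      (\<integral>\<^sup>+w. ennreal (norm (h (w + c) - h w)) * indicator (cball 0 R) w \<partial>lebesgue) \<le> ennreal \<eta>"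
proof -
  define B where "B = (cball 0 (R + 1) :: 'a set)"
  define V where "V = measure lebesgue (cball 0 R :: 'a set)"
  have V: "emeasure lebesgue (cball 0 R :: 'a set) = ennreal V" "V \<ge> 0"
    using emeasure_bounded_finite[OF bounded_cball, of "0 :: 'a" R]
    by (auto simp: V_def intro!: emeasure_eq_ennreal_measure)
  \<comment> \<open>The error \<open>\<eta>\<close> is shared equally between the two approximation errors and the oscillation of the
    continuous approximant; adding 1 avoids dividing by zero when the ball is degenerate.\<close>
  define \<epsilon> where "\<epsilon> = \<eta> / (3 * (V + 1))"
  have "\<epsilon> > 0" using V \<open>\<eta> > 0\<close> by (simp add: \<epsilon>_def)
  obtain g where g: "continuous_on UNIV g"
    and approx: "(\<integral>\<^sup>+w. ennreal (norm (h w - g w)) * indicator B w \<partial>lebesgue) < ennreal (\<eta> / 3)"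
    using continuous_approximation_in_mean[OF h bound, where \<eta> = "\<eta> / 3" and R = "R + 1"] \<open>\<eta> > 0\<close> unfolding B_def by auto
  have gm [measurable]: "g \<in> borel_measurable lebesgue"
    using g by (intro measurable_completion) (simp add: borel_measurable_continuous_onI)
  have "uniformly_continuous_on B g"
    unfolding B_def by (intro compact_uniformly_continuous continuous_on_subset[OF g]) auto
  then obtain \<delta>0 where "\<delta>0 > 0"
    and \<delta>0: "\<And>x y. x \<in> B \<Longrightarrow> y \<in> B \<Longrightarrow> dist y x < \<delta>0 \<Longrightarrow> dist (g y) (g x) < \<epsilon>"
    using \<open>\<epsilon> > 0\<close> unfolding uniformly_continuous_on_def by metis
  show thesis
  proof (rule that[of "min 1 \<delta>0"])
    show "min 1 \<delta>0 > 0" using \<open>\<delta>0 > 0\<close> by simp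
    fix c :: 'a assume c: "norm c < min 1 \<delta>0"
    define D where "D w = ennreal (norm (h w - g w)) * indicator B w" for w
    have Bm [measurable]: "B \<in> sets lebesgue" by (simp add: B_def)
    have [measurable]: "D \<in> borel_measurable lebesgue" unfolding D_def by measurable
    have [measurable]: "(\<lambda>w. D (w + c)) \<in> borel_measurable lebesgue"
      by (rule measurable_compose[OF measurable_lebesgue_translation]) measurable
    have le: "ennreal (norm (h (w + c) - h w)) * indicator (cball 0 R) w
        \<le> (D (w + c) + D w) + ennreal \<epsilon> * indicator (cball 0 R) w" for w
    proof (cases "w \<in> cball 0 R")
      case True
      have wB: "w \<in> B" and wcB: "w + c \<in> B"
        using True c norm_triangle_ineq[of w c] by (auto simp: B_def)
      have "norm (g (w + c) - g w) < \<epsilon>"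
        using \<delta>0[OF wB wcB] c by (simp add: dist_norm)
      moreover have "norm (h (w + c) - h w)
          \<le> norm (h (w + c) - g (w + c)) + norm (g (w + c) - g w) + norm (h w - g w)"
        using norm_triangle_ineq[of "h (w + c) - g (w + c)" "g (w + c) - g w"]
          norm_triangle_ineq4[of "h (w + c) - g w" "h w - g w"] by simp
      ultimately have "norm (h (w + c) - h w) \<le> norm (h (w + c) - g (w + c)) + norm (h w - g w) + \<epsilon>"
        by linarith
      then have "ennreal (norm (h (w + c) - h w)) \<le> ennreal (norm (h (w + c) - g (w + c)) + norm (h w - g w) + \<epsilon>)"
        by (rule ennreal_leI)
      then show ?thesis
        using True wB wcB \<open>\<epsilon> > 0\<close> by (simp add: D_def)
    qed simp
    have "(\<integral>\<^sup>+w. ennreal (norm (h (w + c) - h w)) * indicator (cball 0 R) w \<partial>lebesgue)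
        \<le> (\<integral>\<^sup>+w. (D (w + c) + D w) + ennreal \<epsilon> * indicator (cball 0 R) w \<partial>lebesgue)"
      by (rule nn_integral_mono) (rule le)
    also have "\<dots> = (\<integral>\<^sup>+w. D (w + c) \<partial>lebesgue) + (\<integral>\<^sup>+w. D w \<partial>lebesgue) + ennreal \<epsilon> * ennreal V"
      using V by (simp add: nn_integral_add nn_integral_cmult_indicator)
    also have "(\<integral>\<^sup>+w. D (w + c) \<partial>lebesgue) = (\<integral>\<^sup>+w. D w \<partial>lebesgue)"
      by (rule nn_integral_lebesgue_translation) measurable
    also have "(\<integral>\<^sup>+w. D w \<partial>lebesgue) + (\<integral>\<^sup>+w. D w \<partial>lebesgue) + ennreal \<epsilon> * ennreal V
        \<le> ennreal (\<eta> / 3) + ennreal (\<eta> / 3) + ennreal (\<eta> / 3)"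
    proof (intro add_mono)
      show "(\<integral>\<^sup>+w. D w \<partial>lebesgue) \<le> ennreal (\<eta> / 3)" "(\<integral>\<^sup>+w. D w \<partial>lebesgue) \<le> ennreal (\<eta> / 3)"
        using approx by (auto simp: D_def)
      have "\<epsilon> * V \<le> \<eta> / 3"
        using V \<open>\<eta> > 0\<close> by (simp add: \<epsilon>_def field_simps)
      then show "ennreal \<epsilon> * ennreal V \<le> ennreal (\<eta> / 3)"
        using \<open>\<epsilon> > 0\<close> V by (simp only: ennreal_mult[symmetric] ennreal_leI less_imp_le)
    qed
    also have "\<dots> = ennreal \<eta>"
      using \<open>\<eta> > 0\<close> by (simp add: ennreal_plus[symmetric] del: ennreal_plus)
    finally show "(\<integral>\<^sup>+w. ennreal (norm (h (w + c) - h w)) * indicator (cball 0 R) w \<partial>lebesgue) \<le> ennreal \<eta>" .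
  qed
qed

section \<open>Quasi-periods\<close>

text \<open>
  Translation by \<open>c\<close> multiplies \<open>h\<close> by a unimodular constant times the character of frequency \<open>\<xi>\<close>.
  The constant is left unspecified: it would have to be tracked under composition, while only the
  frequency matters for the rigidity below.  For a section of a line bundle over the torus written
  in a unit frame, the two sewing relations and the eigen equation all have this form.
\<close>

definition quasi_period :: "('a::euclidean_space \<Rightarrow> complex) \<Rightarrow> 'a \<Rightarrow> 'a \<Rightarrow> bool" where
  "quasi_period h c \<xi> \<longleftrightarrow>
     (\<exists>C. norm C = 1 \<and> (AE w in lebesgue. h (w + c) = C * cis (2 * pi * (\<xi> \<bullet> w)) * h w))"

text \<open>
  Composing two translations adds the frequencies; the shift of the argument inside the second
  character contributes only a constant.
\<close>

lemma quasi_period_add: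
  assumes "quasi_period h c \<xi>" and "quasi_period h d \<zeta>"
  shows "quasi_period h (c + d) (\<xi> + \<zeta>)"
proof -
  obtain C where C: "norm C = 1" "AE w in lebesgue. h (w + c) = C * cis (2 * pi * (\<xi> \<bullet> w)) * h w"
    using assms(1) unfolding quasi_period_def by blast
  obtain D where D: "norm D = 1" "AE w in lebesgue. h (w + d) = D * cis (2 * pi * (\<zeta> \<bullet> w)) * h w"
    using assms(2) unfolding quasi_period_def by blast
  have "AE w in lebesgue. h (w + (c + d)) =
      (D * cis (2 * pi * (\<zeta> \<bullet> c)) * C) * cis (2 * pi * ((\<xi> + \<zeta>) \<bullet> w)) * h w"
    using C(2) AE_lebesgue_translation[OF D(2), of c]
    by eventually_elim (simp add: add.assoc inner_simps ring_distribs cis_mult[symmetric])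
  moreover have "norm (D * cis (2 * pi * (\<zeta> \<bullet> c)) * C) = 1"
    using C(1) D(1) by (simp add: norm_mult)
  ultimately show ?thesis unfolding quasi_period_def by blast
qed

lemma quasi_period_minus:
  assumes "quasi_period h c \<xi>"
  shows "quasi_period h (- c) (- \<xi>)"
proof -
  obtain C where C: "norm C = 1" "AE w in lebesgue. h (w + c) = C * cis (2 * pi * (\<xi> \<bullet> w)) * h w"
    using assms unfolding quasi_period_def by blast
  then have "C \<noteq> 0" by auto
  have "AE w in lebesgue. h (w + - c) =
      (inverse C * cis (2 * pi * (\<xi> \<bullet> c))) * cis (2 * pi * (- \<xi> \<bullet> w)) * h w"
    using AE_lebesgue_translation[OF C(2), of "- c"]
  proof eventually_elim
    case (elim w)
    have "h w = C * cis (2 * pi * (\<xi> \<bullet> (w - c))) * h (w - c)"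
      using elim by simp
    moreover have "cis (2 * pi * (\<xi> \<bullet> c)) * cis (2 * pi * (- \<xi> \<bullet> w)) * cis (2 * pi * (\<xi> \<bullet> (w - c))) = 1"
      by (simp add: cis_mult inner_simps algebra_simps)
    ultimately show ?case
      using \<open>C \<noteq> 0\<close> by (simp add: field_simps)
  qed
  moreover have "norm (inverse C * cis (2 * pi * (\<xi> \<bullet> c))) = 1"
    using C(1) by (simp add: norm_mult norm_inverse)
  ultimately show ?thesis unfolding quasi_period_def by blast
qed

lemma quasi_period_int_multiple:
  assumes "quasi_period h c \<xi>"
  shows "quasi_period h (of_int n *\<^sub>R c) (of_int n *\<^sub>R \<xi>)"
proof -
  have nat: "quasi_period h (real k *\<^sub>R c) (real k *\<^sub>R \<xi>)" for k
  proof (induction k)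
    case 0
    show ?case unfolding quasi_period_def by (intro exI[of _ 1]) simp
  next
    case (Suc k)
    show ?case using quasi_period_add[OF assms Suc] by (simp add: scaleR_left_distrib)
  qed
  show ?thesis
  proof (cases "n \<ge> 0")
    case True
    then show ?thesis using nat[of "nat n"] by simp
  next
    case False
    then show ?thesis using quasi_period_minus[OF nat[of "nat (- n)"]] by simp
  qed
qed

text \<open>
  If \<open>c\<close> is small, then \<open>h\<close> translated by \<open>c\<close> is close to \<open>h\<close> in mean, so the unimodular factor \<open>\<psi>\<close> by
  which it differs from \<open>h\<close> is close to 1 on most of the support of \<open>h\<close> in a fixed ball.  The modulus
  of \<open>h\<close> is invariant under every quasi-period \<open>d\<close>, so \<open>\<psi>\<close> is close to 1 at both \<open>w\<close> and \<open>w + d\<close> for most \<open>w\<close> there.  The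
  ratio of these two values is \<open>cis (2 \<pi> \<xi> \<bullet> d)\<close>, which does not depend on \<open>w\<close>.  The point is that \<open>\<delta>\<close>
  depends on \<open>h\<close> alone, and not on the frequencies.
\<close>

lemma quasi_period_almost_orthogonal:
  fixes h :: "'a::euclidean_space \<Rightarrow> complex"
  assumes h [measurable]: "h \<in> borel_measurable lebesgue" and bound: "\<And>w. norm (h w) \<le> 1"
    and nonzero: "\<not> (AE w in lebesgue. h w = 0)"
  obtains \<delta> where "\<delta> > 0"
    "\<And>c \<xi> d \<zeta>. quasi_period h c \<xi> \<Longrightarrow> norm c < \<delta> \<Longrightarrow> quasi_period h d \<zeta> \<Longrightarrow> norm d \<le> 1 \<Longrightarrow>
       norm (cis (2 * pi * (\<xi> \<bullet> d)) - 1) < 1"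
proof -
  obtain R where R: "(\<integral>\<^sup>+w. ennreal (norm (h w)) * indicator (cball 0 (real R)) w \<partial>lebesgue) > 0"
  proof (rule ccontr)
    assume "\<not> thesis"
    then have "(\<integral>\<^sup>+w. ennreal (norm (h w)) * indicator (cball 0 (real n)) w \<partial>lebesgue) = 0" for n
      using that[of n] by (metis not_gr_zero)
    then have "AE w in lebesgue. ennreal (norm (h w)) * indicator (cball 0 (real n)) w = 0" for n
      using h by (subst (asm) nn_integral_0_iff_AE) auto
    then have "AE w in lebesgue. \<forall>n. ennreal (norm (h w)) * indicator (cball 0 (real n)) w = 0"
      unfolding AE_all_countable by blast
    then have "AE w in lebesgue. h w = 0"
    proof eventually_elim
      case (elim w)
      obtain n where "norm w \<le> real n" using real_arch_simple by blast
      then show ?case using elim[rule_format, of n] by (simp add: indicator_def ennreal_eq_0_iff)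
    qed
    with nonzero show False ..
  qed
  let ?I = "\<integral>\<^sup>+w. ennreal (norm (h w)) * indicator (cball 0 (real R)) w \<partial>lebesgue"
  obtain r where r: "0 < ennreal r" "ennreal r < ?I"
  proof -
    obtain y where y: "0 < y" "y < ?I" using R dense by blast
    then have "y \<noteq> top" by auto
    then show ?thesis using y that by (cases y) auto
  qed
  then have "r > 0" by (simp add: ennreal_less_zero_iff)
  \<comment> \<open>The radius grows by 1, the bound on \<open>norm d\<close>, so that the ball of radius \<open>R\<close> shifted by \<open>d\<close> still lies
    in the domain of integration.\<close>
  obtain \<delta> where "\<delta> > 0" and \<delta>: "\<And>c. norm c < \<delta> \<Longrightarrow>
      (\<integral>\<^sup>+w. ennreal (norm (h (w + c) - h w)) * indicator (cball 0 (real R + 1)) w \<partial>lebesgue) \<le> ennreal (r / 2)"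
    using translation_continuous_in_mean[OF h bound, where \<eta> = "r / 2" and R = "real R + 1"] \<open>r > 0\<close> by auto
  show thesis
  proof (rule that[OF \<open>\<delta> > 0\<close>], rule ccontr)
    fix c \<xi> d \<zeta> assume c: "quasi_period h c \<xi>" "norm c < \<delta>" and d: "quasi_period h d \<zeta>" "norm d \<le> 1"
      and far: "\<not> norm (cis (2 * pi * (\<xi> \<bullet> d)) - 1) < 1"
    obtain C where C: "norm C = 1" "AE w in lebesgue. h (w + c) = C * cis (2 * pi * (\<xi> \<bullet> w)) * h w"
      using c(1) unfolding quasi_period_def by blast
    obtain D where D: "norm D = 1" "AE w in lebesgue. h (w + d) = D * cis (2 * pi * (\<zeta> \<bullet> w)) * h w"
      using d(1) unfolding quasi_period_def by blast
    define G where "G w = ennreal (norm (h (w + c) - h w)) * indicator (cball 0 (real R + 1)) w" for w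
    have [measurable]: "(\<lambda>w. h (w + c)) \<in> borel_measurable lebesgue"
      by (rule measurable_compose[OF measurable_lebesgue_translation]) measurable
    have Gm [measurable]: "G \<in> borel_measurable lebesgue" unfolding G_def by measurable
    have [measurable]: "(\<lambda>w. G (w + d)) \<in> borel_measurable lebesgue"
      by (rule measurable_compose[OF measurable_lebesgue_translation]) measurable
    have "AE w in lebesgue. ennreal (norm (h w)) * indicator (cball 0 (real R)) w \<le> G w + G (w + d)"
      using C(2) AE_lebesgue_translation[OF C(2), of d] D(2)
    proof eventually_elim
      case (elim w)
      define \<psi> where "\<psi> x = C * cis (2 * pi * (\<xi> \<bullet> x))" for x
      have "\<psi> (w + d) - \<psi> w = \<psi> w * (cis (2 * pi * (\<xi> \<bullet> d)) - 1)"
        by (simp add: \<psi>_def inner_simps ring_distribs cis_mult[symmetric])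
      then have "norm (\<psi> (w + d) - \<psi> w) \<ge> 1"
        using far C(1) by (simp add: norm_mult \<psi>_def)
      moreover have "norm (\<psi> (w + d) - \<psi> w) \<le> norm (\<psi> w - 1) + norm (\<psi> (w + d) - 1)"
        using norm_triangle_ineq4[of "\<psi> (w + d) - 1" "\<psi> w - 1"] by simp
      ultimately have "norm (h w) \<le> (norm (\<psi> w - 1) + norm (\<psi> (w + d) - 1)) * norm (h w)"
        by (simp add: mult_le_cancel_right1)
      also have "\<dots> = norm (\<psi> w - 1) * norm (h w) + norm (\<psi> (w + d) - 1) * norm (h (w + d))"
        using elim(3) D(1) by (simp add: norm_mult distrib_right)
      also have "\<dots> = norm (h (w + c) - h w) + norm (h (w + d + c) - h (w + d))"
        unfolding norm_mult[symmetric] using elim(1,2) by (simp add: \<psi>_def left_diff_distrib)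
      finally have "ennreal (norm (h w)) \<le> ennreal (norm (h (w + c) - h w)) + ennreal (norm (h (w + d + c) - h (w + d)))"
        by (simp add: ennreal_plus[symmetric] ennreal_leI del: ennreal_plus)
      moreover have "w + d \<in> cball 0 (real R + 1)" if "w \<in> cball 0 (real R)"
        using that d(2) norm_triangle_ineq[of w d] by auto
      ultimately show ?case
        by (auto simp: G_def indicator_def)
    qed
    then have "?I \<le> (\<integral>\<^sup>+w. G w + G (w + d) \<partial>lebesgue)"
      by (rule nn_integral_mono_AE)
    also have "\<dots> = (\<integral>\<^sup>+w. G w \<partial>lebesgue) + (\<integral>\<^sup>+w. G w \<partial>lebesgue)"
      by (simp add: nn_integral_add nn_integral_lebesgue_translation)
    also have "\<dots> \<le> ennreal (r / 2) + ennreal (r / 2)"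
      using \<delta>[OF c(2)] by (intro add_mono) (simp_all add: G_def)
    also have "\<dots> = ennreal r"
      using \<open>r > 0\<close> by (simp add: ennreal_plus[symmetric] del: ennreal_plus)
    finally show False using r(2) by simp
  qed
qed

section \<open>Quasi-periods of charged functions on the plane\<close>

lemma rationally_independent_int_combination:
  assumes "rationally_independent 1 \<alpha> \<beta>"
    and "of_int p + of_int q * \<alpha> + of_int r * \<beta> = 0"
  shows "p = 0 \<and> q = 0 \<and> r = 0"
proof -
  have "of_rat (of_int p) * 1 + of_rat (of_int q) * \<alpha> + of_rat (of_int r) * \<beta> = (0 :: real)"
    using assms(2) by simp
  then show ?thesis
    using assms(1) unfolding rationally_independent_def by (metis of_int_eq_0_iff)
qed

text \<open>
  Kronecker's theorem for the two-dimensional torus.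
\<close>

lemma translation_orbit_dense:
  fixes \<alpha> \<beta> :: real
  assumes indep: "rationally_independent 1 \<alpha> \<beta>" and "\<epsilon> > 0"
  obtains n a b :: int where
    "\<bar>of_int n * \<alpha> - of_int a - x\<bar> < \<epsilon>" "\<bar>of_int n * \<beta> - of_int b - y\<bar> < \<epsilon>"
proof -
  interpret Z: Modules.module "(\<lambda>r. (*) (real_of_int r))"
    by (simp add: Modules.module.intro distrib_left mult.commute)
  define \<theta> where "\<theta> i = (if i = 0 then \<alpha> else if i = 1 then \<beta> else 1)" for i :: nat
  define t where "t i = (if i = 0 then x else y)" for i :: nat
  have lt2: "{..2} = {0, 1, 2 :: nat}" by auto
  note comb = rationally_independent_int_combination[OF indep]
  have ne: "\<alpha> \<noteq> \<beta>" "\<alpha> \<noteq> 1" "\<beta> \<noteq> 1"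
    using comb[of 0 1 "-1"] comb[of "-1" 1 0] comb[of "-1" 0 1] by auto
  then have inj: "inj_on \<theta> {..2}"
    by (auto simp: lt2 inj_on_def \<theta>_def)
  have "Z.independent (\<theta> ` {..2})"
  proof -
    have im: "\<theta> ` {..2} = {1, \<alpha>, \<beta>}"
      by (auto simp: lt2 \<theta>_def)
    have "u v = 0" if "(\<Sum>v\<in>{1, \<alpha>, \<beta>}. of_int (u v) * v) = 0" "v \<in> {1, \<alpha>, \<beta>}" for u :: "real \<Rightarrow> int" and v
      using that comb[of "u 1" "u \<alpha>" "u \<beta>"] ne by (auto simp: add.assoc)
    then show ?thesis
      unfolding im by (subst Z.dependent_finite) auto
  qed
  then obtain n m where nm: "\<And>i. i < 2 \<Longrightarrow> \<bar>of_int n * \<theta> i - of_int (m i) - t i\<bar> < \<epsilon>"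
    using Kronecker_thm_2[of \<theta> 2 \<epsilon> t, OF _ inj _ \<open>\<epsilon> > 0\<close>] by (auto simp: \<theta>_def)
  show thesis
    using nm[of 0] nm[of 1] by (intro that[of n "m 0" "m 1"]) (simp_all add: \<theta>_def t_def)
qed

text \<open>
  The sign condition on \<open>n\<close>, which the density of the orbit does not provide, excludes the trivial
  return \<open>n = 0\<close>.
\<close>

lemma translation_orbit_recurrent:
  fixes \<alpha> \<beta> :: real
  assumes "\<epsilon> > 0"
  obtains n a b :: int where "n > 0"
    "\<bar>of_int n * \<alpha> - of_int a\<bar> < \<epsilon>" "\<bar>of_int n * \<beta> - of_int b\<bar> < \<epsilon>"
proof -
  obtain M :: nat where M: "M > 0" "1 / M < \<epsilon>"
    by (metis assms gr_zeroI inverse_eq_divide real_arch_inverse)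
  define \<theta> where "\<theta> i = (if i = 0 then \<alpha> else \<beta>)" for i :: nat
  obtain n p where np: "0 < n" "\<And>i. i < 2 \<Longrightarrow> \<bar>of_int n * \<theta> i - of_int (p i)\<bar> < 1 / M"
    using Dirichlet_approx_simult[OF M(1), of 2 \<theta>] by metis
  show thesis
    using np(2)[of 0] np(2)[of 1] M(2) np(1) by (intro that[of n "p 0" "p 1"]) (simp_all add: \<theta>_def)
qed

lemma norm_cis_minus_one_ge:
  assumes "\<bar>t - 1 / 2\<bar> \<le> 1 / 4"
  shows "norm (cis (2 * pi * t) - 1) \<ge> 1"
proof -
  have "\<bar>2 * pi * t - pi\<bar> \<le> pi / 2"
  proof -
    have "\<bar>2 * pi * t - pi\<bar> = 2 * pi * \<bar>t - 1 / 2\<bar>"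
      using abs_mult[of "2 * pi" "t - 1 / 2"] by (simp add: algebra_simps)
    also have "\<dots> \<le> 2 * pi * (1 / 4)"
      using assms by (intro mult_left_mono) auto
    finally show ?thesis by simp
  qed
  then have "cos (2 * pi * t - pi) \<ge> 0"
    by (intro cos_ge_zero) linarith+
  then have "Re (cis (2 * pi * t) - 1) \<le> - 1"
    by (simp add: cos_diff)
  then show ?thesis
    using abs_Re_le_cmod[of "cis (2 * pi * t) - 1"] by linarith
qed

text \<open>
  Combining the three quasi-periods, the vector \<open>n \<tau> - (a, b)\<close> is a quasi-period of frequency
  \<open>(n k + b m, n y)\<close>.  When this vector is small, \<open>n k + b m\<close> is close to \<open>n (k + m \<beta>)\<close>, which is
  bounded away from zero since \<open>\<beta>\<close> is irrational and \<open>m \<noteq> 0\<close>: this is where the charge enters.  So a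
  small quasi-period has a frequency whose first entry is a nonzero integer \<open>N\<close>.  The orbit of
  \<open>\<tau>\<close> modulo integer vectors is dense and provides another quasi-period so near to
  \<open>(1 / (2 N), 0)\<close> that the character of that frequency has nonpositive real part there.  This contradicts almost orthogonality unless
  \<open>h\<close> vanishes.
\<close>

lemma charged_quasi_periodic_function_vanishes:
  fixes h :: "real \<times> real \<Rightarrow> complex" and m k :: int and \<alpha> \<beta> y :: real
  assumes h: "h \<in> borel_measurable lebesgue" and bound: "\<And>w. norm (h w) \<le> 1"
    and indep: "rationally_independent 1 \<alpha> \<beta>" and "m \<noteq> 0"
    and q1: "quasi_period h (1, 0) 0" and q2: "quasi_period h (0, 1) (- of_int m, 0)"
    and q\<tau>: "quasi_period h (\<alpha>, \<beta>) (of_int k, y)"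
  shows "AE w in lebesgue. h w = 0"
proof (rule ccontr)
  assume "\<not> (AE w in lebesgue. h w = 0)"
  then obtain \<delta> where "\<delta> > 0" and \<delta>: "\<And>c \<xi> d \<zeta>. quasi_period h c \<xi> \<Longrightarrow> norm c < \<delta> \<Longrightarrow>
      quasi_period h d \<zeta> \<Longrightarrow> norm d \<le> 1 \<Longrightarrow> norm (cis (2 * pi * (\<xi> \<bullet> d)) - 1) < 1"
    using quasi_period_almost_orthogonal[OF h bound] by blast
  have orbit: "quasi_period h (of_int n * \<alpha> - of_int a, of_int n * \<beta> - of_int b)
      (of_int (n * k + b * m), of_int n * y)" for n a b :: int
    using quasi_period_add[OF quasi_period_add[OF quasi_period_int_multiple[OF q\<tau>, of n]
          quasi_period_int_multiple[OF q1, of "- a"]] quasi_period_int_multiple[OF q2, of "- b"]]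
    by (simp add: zero_prod_def)
  define s where "s = \<bar>of_int k + of_int m * \<beta>\<bar>"
  have "s > 0"
    using rationally_independent_int_combination[OF indep, of k 0 m] \<open>m \<noteq> 0\<close> by (auto simp: s_def)
  \<comment> \<open>The first bound makes both coordinates small enough for a vector of length below \<open>\<delta>\<close>; the second
    forces \<open>N \<noteq> 0\<close> below.\<close>
  define \<delta>' where "\<delta>' = min (\<delta> / 2) (s / \<bar>of_int m\<bar>)"
  have "\<delta>' > 0" using \<open>\<delta> > 0\<close> \<open>s > 0\<close> \<open>m \<noteq> 0\<close> by (simp add: \<delta>'_def)
  obtain n a b :: int where n: "n > 0"
    and a: "\<bar>of_int n * \<alpha> - of_int a\<bar> < \<delta>'" and b: "\<bar>of_int n * \<beta> - of_int b\<bar> < \<delta>'"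
    using translation_orbit_recurrent[OF \<open>\<delta>' > 0\<close>] .
  define c where "c = (of_int n * \<alpha> - of_int a, of_int n * \<beta> - of_int b)"
  have "norm c < \<delta>"
    using a b norm_Pair_le[of "of_int n * \<alpha> - of_int a" "of_int n * \<beta> - of_int b"]
    by (simp add: c_def \<delta>'_def)
  define N where "N = n * k + b * m"
  have "N \<noteq> 0"
  proof
    assume "N = 0"
    have "of_int n * (of_int k + of_int m * \<beta>) = of_int m * (of_int n * \<beta> - of_int b)"
    proof -
      have "real_of_int (n * k + b * m) = 0" using \<open>N = 0\<close> by (simp only: N_def of_int_0)
      then show ?thesis by (simp add: algebra_simps)
    qed
    then have "of_int n * s = \<bar>of_int m\<bar> * \<bar>of_int n * \<beta> - of_int b\<bar>"
      using n by (metis abs_mult abs_of_pos of_int_0_less_iff s_def)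
    also have "\<dots> < \<bar>of_int m\<bar> * (s / \<bar>of_int m\<bar>)"
      using b \<open>m \<noteq> 0\<close> by (intro mult_strict_left_mono) (auto simp: \<delta>'_def)
    also have "\<dots> = s" using \<open>m \<noteq> 0\<close> by simp
    finally show False using n \<open>s > 0\<close> by simp
  qed
  define z where "z = of_int n * y"
  \<comment> \<open>With this precision the pairing of the frequency with \<open>(d1, d2)\<close> differs from \<open>1 / 2\<close> by at
    most \<open>1 / 4\<close>.\<close>
  define \<epsilon> where "\<epsilon> = 1 / (4 * (\<bar>of_int N\<bar> + \<bar>z\<bar>))"
  have N1: "\<bar>real_of_int N\<bar> \<ge> 1" using \<open>N \<noteq> 0\<close> by linarith
  then have "\<epsilon> > 0" "\<epsilon> \<le> 1 / 4" by (simp_all add: \<epsilon>_def field_simps)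
  obtain n' a' b' :: int where
    a': "\<bar>of_int n' * \<alpha> - of_int a' - 1 / (2 * of_int N)\<bar> < \<epsilon>" and
    b': "\<bar>of_int n' * \<beta> - of_int b' - 0\<bar> < \<epsilon>"
    using translation_orbit_dense[OF indep \<open>\<epsilon> > 0\<close>] by metis
  define d1 where "d1 = of_int n' * \<alpha> - of_int a'"
  define d2 where "d2 = of_int n' * \<beta> - of_int b'"
  have d1: "\<bar>d1 - 1 / (2 * of_int N)\<bar> < \<epsilon>" and d2: "\<bar>d2\<bar> < \<epsilon>"
    using a' b' by (simp_all add: d1_def d2_def)
  have "\<bar>1 / (2 * real_of_int N)\<bar> \<le> 1 / 2"
    using N1 by (simp add: divide_simps abs_mult)
  then have "norm (d1, d2) \<le> 1"
    using d1 d2 \<open>\<epsilon> \<le> 1 / 4\<close> norm_Pair_le[of d1 d2] unfolding real_norm_def by linarith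
  then have "norm (cis (2 * pi * ((of_int N, z) \<bullet> (d1, d2))) - 1) < 1"
    using \<delta>[OF orbit[of n a b] _ orbit[of n' a' b']] \<open>norm c < \<delta>\<close>
    by (simp add: c_def N_def z_def d1_def d2_def)
  moreover have "\<bar>(of_int N, z) \<bullet> (d1, d2) - 1 / 2\<bar> \<le> 1 / 4"
  proof -
    have "(of_int N, z) \<bullet> (d1, d2) - 1 / 2 = of_int N * (d1 - 1 / (2 * of_int N)) + z * d2"
      using \<open>N \<noteq> 0\<close> by (simp add: field_simps)
    also have "\<bar>\<dots>\<bar> \<le> \<bar>of_int N\<bar> * \<bar>d1 - 1 / (2 * of_int N)\<bar> + \<bar>z\<bar> * \<bar>d2\<bar>"
      by (metis abs_mult abs_triangle_ineq)
    also have "\<dots> \<le> \<bar>of_int N\<bar> * \<epsilon> + \<bar>z\<bar> * \<epsilon>"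
      using d1 d2 by (intro add_mono mult_left_mono) auto
    also have "\<dots> = (\<bar>of_int N\<bar> + \<bar>z\<bar>) * \<epsilon>"
      by (simp add: distrib_right)
    also have "\<dots> = 1 / 4"
      using N1 by (simp add: \<epsilon>_def del: distrib_left_numeral)
    finally show ?thesis .
  qed
  ultimately show False
    using norm_cis_minus_one_ge by fastforce
qed

section \<open>The coordinate of a section carried by the line\<close>

lemma cinner_self_unit:
  assumes "norm x = 1"
  shows "cinner x x = 1"
proof -
  have "cinner x x = of_real (\<Sum>i\<in>UNIV. (norm (x $ i))\<^sup>2)"
    unfolding cinner_def of_real_sum
    by (intro sum.cong refl) (simp only: complex_norm_square mult.commute)
  also have "(\<Sum>i\<in>UNIV. (norm (x $ i))\<^sup>2) = (norm x)\<^sup>2"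
    by (simp add: norm_vec_def L2_set_def sum_nonneg)
  finally show ?thesis using assms by simp
qed

lemma complex_line_coordinate:
  assumes "L \<in> complex_lines" "x \<in> L" "y \<in> L" "norm x = 1"
  shows "y = cinner x y *s x"
proof -
  obtain v where "L = vec.span {v}"
    using assms(1) by (auto simp: complex_lines_def)
  then obtain a b where ab: "x = a *s v" "y = b *s v"
    using assms(2,3) by (auto simp: vec.span_singleton)
  then have "a \<noteq> 0" using assms(4) by auto
  then have y: "y = (b / a) *s x" using ab by simp
  have "cinner x y = (b / a) * cinner x x"
    unfolding y by (simp add: cinner_def sum_distrib_left algebra_simps)
  then show ?thesis using y cinner_self_unit[OF assms(4)] by simp
qed

lemma borel_measurable_cinner:
  fixes e F :: "'a \<Rightarrow> complex ^ 'n"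
  assumes e: "e \<in> borel_measurable M" and F: "F \<in> borel_measurable M"
  shows "(\<lambda>w. cinner (e w) (F w)) \<in> borel_measurable M"
proof -
  have nth: "(\<lambda>w. f w $ i) \<in> borel_measurable M" if "f \<in> borel_measurable M" for f :: "'a \<Rightarrow> complex ^ 'n" and i
    using that by (rule borel_measurable_continuous_on[rotated]) (intro continuous_intros)
  have "(\<lambda>w. cnj (e w $ i)) \<in> borel_measurable M" for i
    using nth[OF e] by (rule borel_measurable_continuous_on[rotated]) (intro continuous_intros)
  then show ?thesis
    unfolding cinner_def using nth[OF F] by (intro borel_measurable_sum borel_measurable_times)
qed

lemma invariant_line_multiplier:
  assumes line: "invariant_line U1 U2 A \<tau> l" and inv: "invertible (A w)"
    and unit: "\<And>w. norm (e w) = 1" and e: "\<And>w. e w \<in> l w"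
  shows "A w *v e w = multiplier A \<tau> e w *s e (w + \<tau>)" and "multiplier A \<tau> e w \<noteq> 0"
proof -
  have "A w *v e w \<in> l (w + \<tau>)"
    using line e[of w] unfolding invariant_line_def by blast
  then show eq: "A w *v e w = multiplier A \<tau> e w *s e (w + \<tau>)"
    unfolding multiplier_def
    using invariant_line_complex_lines[OF line] e unit by (intro complex_line_coordinate) auto
  have "e w \<noteq> 0" using unit[of w] by auto
  then have "A w *v e w \<noteq> 0"
    using inv by (metis invertible_def matrix_vector_mul_assoc matrix_vector_mul_lid matrix_vector_mult_0_right)
  then show "multiplier A \<tau> e w \<noteq> 0" using eq by auto
qed

text \<open>
  In the frame \<open>e\<close> the sewing matrices and the cocycle become scalars.  The nontrivial factor in
  the direction \<open>e2\<close> is the inverse of the one in the definition of a normalized unit section.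
\<close>

lemma carried_section_coordinate:
  fixes U1 U2 A :: "real \<times> real \<Rightarrow> complex ^ 'n ^ 'n"
  assumes line: "invariant_line U1 U2 A \<tau> l" and inv: "\<And>w. invertible (A w)"
    and nus: "normalized_unit_section U1 U2 l m e"
    and sec: "measurable_section U1 U2 F" and eig: "eigen_equation A \<tau> lam F" and car: "carried_by l F"
  obtains \<phi> where "\<phi> \<in> borel_measurable lebesgue" "AE w in lebesgue. F w = \<phi> w *s e w"
    "AE w in lebesgue. \<phi> (w + (1, 0)) = \<phi> w"
    "AE w in lebesgue. \<phi> (w + (0, 1)) = cis (- 2 * pi * of_int m * fst w) * \<phi> w"
    "AE w in lebesgue. multiplier A \<tau> e w * \<phi> w = lam * \<phi> (w + \<tau>)"
proof -
  have e: "continuous_on UNIV e" "\<And>w. norm (e w) = 1" "\<And>w. e w \<in> l w"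
      "\<And>w. e (w + (1, 0)) = U1 w *v e w"
      "\<And>w. e (w + (0, 1)) = exp (2 * of_real pi * \<i> * of_int m * of_real (fst w)) *s (U2 w *v e w)"
    using nus unfolding normalized_unit_section_def e1_def e2_def by auto
  have e0: "e w \<noteq> 0" for w using e(2)[of w] by auto
  define \<phi> where "\<phi> w = cinner (e w) (F w)" for w
  have F_meas: "F \<in> borel_measurable lebesgue"
    and F1: "AE w in lebesgue. F (w + (1, 0)) = U1 w *v F w"
    and F2: "AE w in lebesgue. F (w + (0, 1)) = U2 w *v F w"
    using sec unfolding measurable_section_def e1_def e2_def by auto
  have \<phi>F: "AE w in lebesgue. F w = \<phi> w *s e w"
    using car unfolding carried_by_def
  proof eventually_elim
    case (elim w)
    then show ?case
      unfolding \<phi>_def using invariant_line_complex_lines[OF line] e by (intro complex_line_coordinate) auto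
  qed
  have "e \<in> borel_measurable lebesgue"
    using e(1) by (intro measurable_completion) (simp add: borel_measurable_continuous_onI)
  then have "\<phi> \<in> borel_measurable lebesgue"
    unfolding \<phi>_def using F_meas by (rule borel_measurable_cinner)
  moreover note \<phi>F
  moreover have "AE w in lebesgue. \<phi> (w + (1, 0)) = \<phi> w"
    using F1 \<phi>F AE_lebesgue_translation[OF \<phi>F, of "(1, 0)"]
  proof eventually_elim
    case (elim w)
    then have "\<phi> (w + (1, 0)) *s e (w + (1, 0)) = \<phi> w *s e (w + (1, 0))"
      by (simp add: e(4) vec.scale)
    then show ?case using e0 by simp
  qed
  moreover have "AE w in lebesgue. \<phi> (w + (0, 1)) = cis (- 2 * pi * of_int m * fst w) * \<phi> w"
    using F2 \<phi>F AE_lebesgue_translation[OF \<phi>F, of "(0, 1)"]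
  proof eventually_elim
    case (elim w)
    define E where "E = cis (2 * pi * of_int m * fst w)"
    have eE: "e (w + (0, 1)) = E *s (U2 w *v e w)"
      unfolding e(5) E_def by (simp add: cis_conv_exp algebra_simps)
    then have "U2 w *v e w \<noteq> 0" using e0[of "w + (0, 1)"] by auto
    moreover have "(\<phi> (w + (0, 1)) * E) *s (U2 w *v e w) = \<phi> w *s (U2 w *v e w)"
      using elim by (simp add: eE vec.scale)
    ultimately have "\<phi> (w + (0, 1)) * E = \<phi> w"
      by (metis vec.scale_right_imp_eq)
    moreover have "E * cis (- 2 * pi * of_int m * fst w) = 1"
      by (simp add: E_def cis_mult)
    ultimately show ?case
      by (metis mult.assoc mult.commute mult.right_neutral)
  qed
  moreover have "AE w in lebesgue. multiplier A \<tau> e w * \<phi> w = lam * \<phi> (w + \<tau>)"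
    using eig[unfolded eigen_equation_def] \<phi>F AE_lebesgue_translation[OF \<phi>F, of \<tau>]
  proof eventually_elim
    case (elim w)
    have "(multiplier A \<tau> e w * \<phi> w) *s e (w + \<tau>) = (lam * \<phi> (w + \<tau>)) *s e (w + \<tau>)"
      using elim invariant_line_multiplier(1)[OF line inv e(2,3), of w]
      by (simp add: vec.scale mult.commute)
    then show ?case using e0 by simp
  qed
  ultimately show thesis by (rule that)
qed

text \<open>
  An eigenvalue 0 forces the coordinate \<open>\<phi>\<close> to vanish because the multiplier \<open>q\<close> has no zeros.
  Otherwise the modulus of \<open>q\<close> is removed by passing to \<open>sgn \<phi>\<close>, and the nonlinear part \<open>g\<close> of the
  phase of \<open>q\<close> by the factor built from the transfer function \<open>v\<close>.  The product \<open>h\<close> has the same zeros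
  as \<open>\<phi>\<close> and is left with linear phases only; periodicity of \<open>v\<close> keeps the charge unchanged.
\<close>

lemma carried_eigensection_vanishes:
  fixes U1 U2 A :: "real \<times> real \<Rightarrow> complex ^ 'n ^ 'n" and \<alpha> \<beta> :: real
  assumes inv: "\<And>w. invertible (A w)" and indep: "rationally_independent 1 \<alpha> \<beta>"
    and line: "invariant_line U1 U2 A (\<alpha>, \<beta>) l" and charge: "chern_number U1 U2 l \<noteq> 0"
    and cob: "phase_coboundary U1 U2 A (\<alpha>, \<beta>) l"
    and sec: "measurable_section U1 U2 F" and eig: "eigen_equation A (\<alpha>, \<beta>) lam F" and car: "carried_by l F"
  shows "AE w in lebesgue. F w = 0"
proof -
  obtain m e g v where nus: "normalized_unit_section U1 U2 l m e"
    and zwp: "zero_winding_phase (phase A (\<alpha>, \<beta>) m e) g"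
    and v: "v \<in> borel_measurable lebesgue" "periodic v"
    and v\<tau>: "AE w in lebesgue. v w - v (w + (\<alpha>, \<beta>)) = g w - torus_mean g"
    using cob unfolding phase_coboundary_def by blast
  have "m \<noteq> 0"
    using chern_number_eq_charge[OF invariant_line_complex_lines[OF line] nus] charge by simp
  obtain k1 k2 :: int where p: "\<And>w. phase A (\<alpha>, \<beta>) m e w =
      exp (2 * of_real pi * \<i> * of_real (of_int k1 * fst w + of_int k2 * snd w + g w))"
    using zwp unfolding zero_winding_phase_def by blast
  define q where "q = multiplier A (\<alpha>, \<beta>) e"
  have q0: "q w \<noteq> 0" for w
    unfolding q_def using nus
    by (intro invariant_line_multiplier(2)[OF line inv]) (auto simp: normalized_unit_section_def)
  obtain \<phi> where \<phi>_meas [measurable]: "\<phi> \<in> borel_measurable lebesgue"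
    and \<phi>F: "AE w in lebesgue. F w = \<phi> w *s e w"
    and \<phi>1: "AE w in lebesgue. \<phi> (w + (1, 0)) = \<phi> w"
    and \<phi>2: "AE w in lebesgue. \<phi> (w + (0, 1)) = cis (- 2 * pi * of_int m * fst w) * \<phi> w"
    and \<phi>\<tau>: "AE w in lebesgue. q w * \<phi> w = lam * \<phi> (w + (\<alpha>, \<beta>))"
    unfolding q_def by (rule carried_section_coordinate[OF line inv nus sec eig car])
  have "AE w in lebesgue. \<phi> w = 0"
  proof (cases "lam = 0")
    case True
    show ?thesis using \<phi>\<tau> by eventually_elim (use q0 True in simp)
  next
    case False
    define h where "h w = sgn (\<phi> w) * cis (2 * pi * v w)" for w
    have per: "v (w + (1, 0)) = v w" "v (w + (0, 1)) = v w" for w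
      using v(2) unfolding periodic_def e1_def e2_def by blast+
    have sgn_q: "sgn (q w) = cis (2 * pi * (of_int k1 * fst w + (of_int k2 - of_int m * \<alpha>) * snd w + g w))" for w
    proof -
      have "sgn (q w) * cis (2 * pi * (of_int m * \<alpha> * snd w)) = phase A (\<alpha>, \<beta>) m e w"
        by (simp add: phase_def q_def sgn_eq cis_conv_exp algebra_simps)
      also have "\<dots> = cis (2 * pi * (of_int k1 * fst w + of_int k2 * snd w + g w))"
        unfolding p by (simp add: cis_conv_exp algebra_simps)
      finally have "sgn (q w) = cis (2 * pi * (of_int k1 * fst w + of_int k2 * snd w + g w))
          / cis (2 * pi * (of_int m * \<alpha> * snd w))"
        by (simp add: field_simps)
      then show ?thesis by (simp add: cis_divide algebra_simps)
    qed
    have "AE w in lebesgue. h w = 0"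
    proof (rule charged_quasi_periodic_function_vanishes[OF _ _ indep \<open>m \<noteq> 0\<close>])
      have "(\<lambda>w. sgn (\<phi> w)) \<in> borel_measurable lebesgue"
        unfolding sgn_div_norm by measurable
      moreover have "(\<lambda>w. cis (2 * pi * v w)) \<in> borel_measurable lebesgue"
        using v(1) by (rule borel_measurable_continuous_on[rotated]) (intro continuous_intros)
      ultimately show "h \<in> borel_measurable lebesgue"
        unfolding h_def by (rule borel_measurable_times)
      show "norm (h w) \<le> 1" for w
        by (simp add: h_def norm_mult norm_sgn)
      show "quasi_period h (1, 0) 0"
        unfolding quasi_period_def
      proof (intro exI conjI)
        show "AE w in lebesgue. h (w + (1, 0)) = 1 * cis (2 * pi * (0 \<bullet> w)) * h w"
          using \<phi>1 by eventually_elim (simp add: h_def per)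
      qed simp
      show "quasi_period h (0, 1) (- of_int m, 0)"
        unfolding quasi_period_def
      proof (intro exI conjI)
        show "AE w in lebesgue. h (w + (0, 1)) = 1 * cis (2 * pi * ((- of_int m, 0) \<bullet> w)) * h w"
          using \<phi>2
          by eventually_elim (simp add: h_def per sgn_mult inner_prod_def sgn_eq[of "cis _"] mult.assoc)
      qed simp
      show "quasi_period h (\<alpha>, \<beta>) (of_int k1, of_int k2 - of_int m * \<alpha>)"
        unfolding quasi_period_def
      proof (intro exI conjI)
        show "AE w in lebesgue. h (w + (\<alpha>, \<beta>)) = (cis (2 * pi * torus_mean g) / sgn lam) *
            cis (2 * pi * ((of_int k1, of_int k2 - of_int m * \<alpha>) \<bullet> w)) * h w"
          using \<phi>\<tau> v\<tau>
        proof eventually_elim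
          case (elim w)
          have "sgn (q w) * sgn (\<phi> w) = sgn lam * sgn (\<phi> (w + (\<alpha>, \<beta>)))"
            using elim(1) by (metis sgn_mult)
          then have "sgn (\<phi> (w + (\<alpha>, \<beta>))) = sgn (q w) * sgn (\<phi> w) / sgn lam"
            using False by (simp add: field_simps sgn_zero_iff)
          moreover have "v (w + (\<alpha>, \<beta>)) = v w - g w + torus_mean g"
            using elim(2) by simp
          moreover have "sgn (q w) * cis (2 * pi * (v w - g w + torus_mean g)) =
              cis (2 * pi * torus_mean g) * cis (2 * pi * ((of_int k1, of_int k2 - of_int m * \<alpha>) \<bullet> w))
              * cis (2 * pi * v w)"
            unfolding sgn_q cis_mult by (simp add: inner_prod_def algebra_simps)
          ultimately show ?case
            by (simp add: h_def)
        qed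
        show "norm (cis (2 * pi * torus_mean g) / sgn lam) = 1"
          using False by (simp add: norm_divide norm_sgn)
      qed
    qed
    then show ?thesis
      by eventually_elim (simp add: h_def sgn_zero_iff)
  qed
  with \<phi>F show ?thesis
    by eventually_elim simp
qed

section \<open>Absence of carried eigensections\<close>

theorem theoremA:
  fixes U1 U2 A :: "real \<times> real \<Rightarrow> complex ^ 'n ^ 'n"
    and l :: "real \<times> real \<Rightarrow> (complex ^ 'n) set"
    and \<alpha> \<beta> :: real and \<tau> :: "real \<times> real"
  assumes "sewing_system U1 U2"
    and "\<tau> = (\<alpha>, \<beta>)"
    and "equivariant_cocycle U1 U2 \<tau> A"
    and "rationally_independent 1 \<alpha> \<beta>"
    and "invariant_line U1 U2 A \<tau> l"
    and "chern_number U1 U2 l \<noteq> 0"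
    and "phase_coboundary U1 U2 A \<tau> l"
  shows "(\<forall>lam F. measurable_section U1 U2 F \<and> eigen_equation A \<tau> lam F \<and> carried_by l F
            \<longrightarrow> (AE w in lebesgue. F w = 0))
       \<and> (\<nexists>F. measurable_eigensection U1 U2 A \<tau> F \<and> carried_by l F)
       \<and> (\<nexists>F. L2_section U1 U2 F \<and> measurable_eigensection U1 U2 A \<tau> F \<and> carried_by l F)"
proof -
  have inv: "invertible (A w)" for w
    using assms(3) unfolding equivariant_cocycle_def by blast
  have "AE w in lebesgue. F w = 0"
    if "measurable_section U1 U2 F" "eigen_equation A \<tau> lam F" "carried_by l F" for lam F
    using carried_eigensection_vanishes[of A, OF inv assms(4)] assms(5-7) that
    unfolding assms(2) by blast
  then show ?thesis
    unfolding measurable_eigensection_def by blast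
qed

end
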